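(* Let $K$ be a field of characteristic zero and $A_n(K)$ the $n$-th Weyl algebra over $K$, graded by $\deg X_i=1$, $\deg\partial_i=-1$. Let $M$ be a finitely generated graded left $A_n(K)$-module. Then $M$ is generalized Eulerian if and only if it is strongly generalized Eulerian.
   Context: $A_n(K)=K\langle X_1,\ldots,X_n,\partial_1,\ldots,\partial_n\rangle$. Let $\mathcal{E}_n=\sum_{i=1}^n X_i\partial_i$, and write $|w|=\deg w$ for homogeneous $w$. A graded left $A_n(K)$-module $W$ is generalized Eulerian if for each homogeneous $w\in W$ there is a positive integer $a$, depending on $w$, with $(\mathcal{E}_n-|w|)^a w=0$. It is strongly generalized Eulerian if there is an integer $a>0$, independent of $w$, with $(\mathcal{E}_n-|w|)^a w=0$ for all homogeneous $w\in W$. *)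

theory Defs
  imports Complex_Main "HOL-Library.Poly_Mapping"
begin

section \<open>Polynomials in finitely many variables\<close>

text \<open>The ring \<open>K[X\<^sub>1, \<dots>, X\<^sub>n]\<close>: the variables are indexed by a finite type \<open>'n\<close> with
  \<open>n = CARD('n)\<close>, and a polynomial maps exponent vectors to coefficients.\<close>

type_synonym ('n, 'k) polyn = "('n \<Rightarrow>\<^sub>0 nat) \<Rightarrow>\<^sub>0 'k"

definition polyn_const :: "'k::field \<Rightarrow> ('n, 'k) polyn"
  where "polyn_const c = Poly_Mapping.single 0 c"

definition polyn_var :: "'n \<Rightarrow> ('n, 'k::field) polyn"
  where "polyn_var i = Poly_Mapping.single (Poly_Mapping.single i 1) 1"

text \<open>The partial derivative, coefficientwise; see \<open>polyn_deriv_single\<close> for its values on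
  monomials.\<close>

lift_definition polyn_deriv :: "'n \<Rightarrow> ('n, 'k::field) polyn \<Rightarrow> ('n, 'k) polyn"
  is "\<lambda>i p m. of_nat (Suc (Poly_Mapping.lookup m i)) * p (m + Poly_Mapping.single i 1)"
proof -
  fix i :: 'n and p :: "('n \<Rightarrow>\<^sub>0 nat) \<Rightarrow> 'k"
  assume fin: "finite {m. p m \<noteq> 0}"
  have "inj (\<lambda>m::'n \<Rightarrow>\<^sub>0 nat. m + Poly_Mapping.single i 1)"
    by (auto intro: injI)
  then have "finite ((\<lambda>m. m + Poly_Mapping.single i 1) -` {m. p m \<noteq> 0})"
    using fin by (rule finite_vimageI[rotated])
  then show "finite {m. of_nat (Suc (Poly_Mapping.lookup m i)) * p (m + Poly_Mapping.single i 1) \<noteq> 0}"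
    by (rule rev_finite_subset) auto
qed

lemma lookup_polyn_deriv:
  "Poly_Mapping.lookup (polyn_deriv i p) m =
    of_nat (Suc (Poly_Mapping.lookup m i)) * Poly_Mapping.lookup p (m + Poly_Mapping.single i 1)"
  by transfer simp

lemma polyn_deriv_add: "polyn_deriv i (p + q) = polyn_deriv i p + polyn_deriv i q"
  by (rule poly_mapping_eqI) (simp add: lookup_polyn_deriv lookup_add algebra_simps)

lemma polyn_deriv_single:
  "polyn_deriv i (Poly_Mapping.single m c) =
    Poly_Mapping.single (m - Poly_Mapping.single i 1) (of_nat (Poly_Mapping.lookup m i) * c)"
proof (rule poly_mapping_eqI)
  fix k
  have eq: "(m = k + Poly_Mapping.single i 1) \<longleftrightarrow>
      m - Poly_Mapping.single i 1 = k \<and> Poly_Mapping.lookup m i \<noteq> 0"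
  proof
    assume "m = k + Poly_Mapping.single i 1"
    then show "m - Poly_Mapping.single i 1 = k \<and> Poly_Mapping.lookup m i \<noteq> 0"
      by (simp add: lookup_add)
  next
    assume *: "m - Poly_Mapping.single i 1 = k \<and> Poly_Mapping.lookup m i \<noteq> 0"
    show "m = k + Poly_Mapping.single i 1"
    proof (rule poly_mapping_eqI)
      fix j
      show "Poly_Mapping.lookup m j = Poly_Mapping.lookup (k + Poly_Mapping.single i 1) j"
        using * by (cases "i = j") (auto simp: lookup_add lookup_minus lookup_single when_def)
    qed
  qed
  show "Poly_Mapping.lookup (polyn_deriv i (Poly_Mapping.single m c)) k = Poly_Mapping.lookup
      (Poly_Mapping.single (m - Poly_Mapping.single i 1) (of_nat (Poly_Mapping.lookup m i) * c)) k"
  proof (cases "m = k + Poly_Mapping.single i 1")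
    case True
    then show ?thesis by (simp add: lookup_polyn_deriv lookup_add)
  next
    case False
    then show ?thesis using eq
      by (auto simp: lookup_polyn_deriv lookup_single when_def)
  qed
qed

lemma polyn_induct [case_names add single]:
  fixes p :: "('n, 'k::field) polyn"
  assumes add: "\<And>p q. P p \<Longrightarrow> P q \<Longrightarrow> P (p + q)"
    and single: "\<And>m c. P (Poly_Mapping.single m c)"
  shows "P p"
proof (induction p rule: update_induct)
  case const
  then show ?case using single[of 0 0] by simp
next
  case (update p m c)
  then have "Poly_Mapping.update m c p = p + Poly_Mapping.single m c"
    by (intro poly_mapping_eqI)
      (auto simp: lookup_add lookup_update lookup_single when_def in_keys_iff)
  then show ?case using add single update by metis
qed

section \<open>The Weyl algebra\<close>

text \<open>\<open>A\<^sub>n(K) = K\<langle>X\<^sub>1, \<dots>, X\<^sub>n, \<partial>\<^sub>1, \<dots>, \<partial>\<^sub>n\<rangle>\<close> is the \<open>K\<close>-subalgebra of the \<open>K\<close>-linear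
  endomorphisms of \<open>K[X\<^sub>1, \<dots>, X\<^sub>n]\<close> generated by the multiplications by the variables
  and the partial derivatives.\<close>

inductive_set weyl_ops :: "(('n, 'k::field) polyn \<Rightarrow> ('n, 'k) polyn) set" where
  scalar: "(\<lambda>p. polyn_const c * p) \<in> weyl_ops"
| var: "(\<lambda>p. polyn_var i * p) \<in> weyl_ops"
| deriv: "polyn_deriv i \<in> weyl_ops"
| add: "f \<in> weyl_ops \<Longrightarrow> g \<in> weyl_ops \<Longrightarrow> (\<lambda>p. f p + g p) \<in> weyl_ops"
| comp: "f \<in> weyl_ops \<Longrightarrow> g \<in> weyl_ops \<Longrightarrow> (\<lambda>p. f (g p)) \<in> weyl_ops"

typedef (overloaded) ('n, 'k) weyl = "weyl_ops :: (('n, 'k::field) polyn \<Rightarrow> ('n, 'k) polyn) set"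
  morphisms weyl_app Weyl
  using weyl_ops.scalar by blast

setup_lifting type_definition_weyl

lemma polyn_const_0 [simp]: "polyn_const 0 = 0"
  by (simp add: polyn_const_def)

lemma polyn_const_1 [simp]: "polyn_const 1 = 1"
  by (simp add: polyn_const_def)

lemma weyl_ops_additive: "f \<in> weyl_ops \<Longrightarrow> f (p + q) = f p + f q"
  by (induction arbitrary: p q rule: weyl_ops.induct)
    (simp_all add: polyn_deriv_add algebra_simps)

lemma weyl_ops_zero: "(\<lambda>p. 0) \<in> weyl_ops"
proof -
  have "(\<lambda>p. polyn_const 0 * p) = (\<lambda>p. 0)"
    by (rule ext) simp
  with weyl_ops.scalar show ?thesis
    by (rule back_subst[of "\<lambda>f. f \<in> weyl_ops"])
qed

lemma weyl_ops_id: "(\<lambda>p. p) \<in> weyl_ops"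
proof -
  have "(\<lambda>p. polyn_const 1 * p) = (\<lambda>p. p)"
    by (rule ext) simp
  with weyl_ops.scalar show ?thesis
    by (rule back_subst[of "\<lambda>f. f \<in> weyl_ops"])
qed

lemma weyl_ops_uminus: "f \<in> weyl_ops \<Longrightarrow> (\<lambda>p. - f p) \<in> weyl_ops"
  using weyl_ops.comp[OF weyl_ops.scalar[of "- 1"], of f]
  by (simp add: polyn_const_def single_uminus)

lemma weyl_ops_minus: "f \<in> weyl_ops \<Longrightarrow> g \<in> weyl_ops \<Longrightarrow> (\<lambda>p. f p - g p) \<in> weyl_ops"
  using weyl_ops.add[of f "\<lambda>p. - g p"] weyl_ops_uminus[of g] by simp

instantiation weyl :: (type, field) ring_1
begin

lift_definition zero_weyl :: "('a, 'b) weyl" is "\<lambda>p. 0"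
  by (rule weyl_ops_zero)

lift_definition one_weyl :: "('a, 'b) weyl" is "\<lambda>p. p"
  by (rule weyl_ops_id)

lift_definition plus_weyl :: "('a, 'b) weyl \<Rightarrow> ('a, 'b) weyl \<Rightarrow> ('a, 'b) weyl"
  is "\<lambda>f g p. f p + g p"
  by (rule weyl_ops.add)

lift_definition minus_weyl :: "('a, 'b) weyl \<Rightarrow> ('a, 'b) weyl \<Rightarrow> ('a, 'b) weyl"
  is "\<lambda>f g p. f p - g p"
  by (rule weyl_ops_minus)

lift_definition uminus_weyl :: "('a, 'b) weyl \<Rightarrow> ('a, 'b) weyl"
  is "\<lambda>f p. - f p"
  by (rule weyl_ops_uminus)

lift_definition times_weyl :: "('a, 'b) weyl \<Rightarrow> ('a, 'b) weyl \<Rightarrow> ('a, 'b) weyl"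
  is "\<lambda>f g p. f (g p)"
  by (rule weyl_ops.comp)

instance
proof
  show "(0 :: ('a, 'b) weyl) \<noteq> 1"
    by transfer (metis zero_neq_one)
qed (transfer; simp add: fun_eq_iff weyl_ops_additive algebra_simps)+

end

lift_definition weyl_const :: "'k::field \<Rightarrow> ('n, 'k) weyl" is "\<lambda>c p. polyn_const c * p"
  by (rule weyl_ops.scalar)

lift_definition weyl_X :: "'n \<Rightarrow> ('n, 'k::field) weyl" is "\<lambda>i p. polyn_var i * p"
  by (rule weyl_ops.var)

lift_definition weyl_D :: "'n \<Rightarrow> ('n, 'k::field) weyl" is polyn_deriv
  by (rule weyl_ops.deriv)

lemma weyl_X_X: "weyl_X i * weyl_X j = weyl_X j * weyl_X i"
  by transfer (simp add: fun_eq_iff algebra_simps)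

lemma weyl_D_D: "weyl_D i * weyl_D j = (weyl_D j * weyl_D i :: ('n, 'k::field) weyl)"
proof (transfer, rule ext)
  fix i j :: 'n and p :: "('n, 'k) polyn"
  show "polyn_deriv i (polyn_deriv j p) = polyn_deriv j (polyn_deriv i p)"
    by (rule poly_mapping_eqI)
      (auto simp: lookup_polyn_deriv lookup_add lookup_single when_def ac_simps)
qed

lemma weyl_D_X:
  "weyl_D i * weyl_X j =
    (weyl_X j * weyl_D i + (if i = j then 1 else 0) :: ('n, 'k::field) weyl)"
proof -
  have leibniz: "polyn_deriv i (polyn_var j * p) =
      polyn_var j * polyn_deriv i p + (if i = j then p else 0)"
    for i j :: 'n and p :: "('n, 'k) polyn"
  proof (induction p rule: polyn_induct)
    case (add p q)
    then show ?case by (simp add: distrib_left polyn_deriv_add)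
  next
    case (single m c)
    show ?case
    proof (cases "i = j")
      case True
      show ?thesis
      proof (cases "Poly_Mapping.lookup m i = 0")
        case True
        then show ?thesis using \<open>i = j\<close>
          by (simp add: polyn_var_def mult_single polyn_deriv_single lookup_add)
      next
        case False
        then have "Poly_Mapping.single i 1 + (m - Poly_Mapping.single i 1) = m"
          by (intro poly_mapping_eqI) (auto simp: lookup_add lookup_minus lookup_single when_def)
        then show ?thesis using \<open>i = j\<close>
          by (simp add: polyn_var_def mult_single polyn_deriv_single lookup_add
              algebra_simps flip: single_add)
      qed
    next
      case False
      then have "Poly_Mapping.single j 1 + m - Poly_Mapping.single i 1 =
          Poly_Mapping.single j 1 + (m - Poly_Mapping.single i 1)"
        by (intro poly_mapping_eqI) (auto simp: lookup_add lookup_minus lookup_single when_def)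
      with False show ?thesis
        by (simp add: polyn_var_def mult_single polyn_deriv_single lookup_add lookup_single)
    qed
  qed
  show ?thesis
  proof (cases "i = j")
    case True
    then show ?thesis by simp (transfer, simp add: fun_eq_iff leibniz)
  next
    case False
    then show ?thesis by simp (transfer, simp add: fun_eq_iff leibniz)
  qed
qed

text \<open>The grading: \<open>weyl_hom d\<close> is the \<open>K\<close>-span of the words of weight \<open>d\<close> in the generators,
  where each \<open>X\<^sub>i\<close> has weight 1, each \<open>\<partial>\<^sub>i\<close> has weight -1 and constants have weight 0.\<close>

inductive weyl_hom :: "int \<Rightarrow> ('n, 'k::field) weyl \<Rightarrow> bool" where
  zero: "weyl_hom d 0"
| const: "weyl_hom 0 (weyl_const c)"
| X: "weyl_hom 1 (weyl_X i)"
| D: "weyl_hom (- 1) (weyl_D i)"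
| add: "weyl_hom d a \<Longrightarrow> weyl_hom d b \<Longrightarrow> weyl_hom d (a + b)"
| mult: "weyl_hom d a \<Longrightarrow> weyl_hom e b \<Longrightarrow> weyl_hom (d + e) (a * b)"

definition weyl_component :: "int \<Rightarrow> ('n, 'k::field) weyl set"
  where "weyl_component d = {a. weyl_hom d a}"

definition euler :: "('n::finite, 'k::field) weyl"
  where "euler = (\<Sum>i\<in>UNIV. weyl_X i * weyl_D i)"

section \<open>Graded left modules\<close>

locale left_module =
  fixes act :: "'r::ring_1 \<Rightarrow> 'm::ab_group_add \<Rightarrow> 'm"
  assumes act_add_right: "act a (x + y) = act a x + act a y"
    and act_add_left: "act (a + b) x = act a x + act b x"
    and act_mult: "act (a * b) x = act a (act b x)"
    and act_one: "act 1 x = x"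

definition finitely_generated :: "('r::ring_1 \<Rightarrow> 'm::ab_group_add \<Rightarrow> 'm) \<Rightarrow> bool"
  where "finitely_generated act \<longleftrightarrow>
    (\<exists>S. finite S \<and> (\<forall>x. \<exists>a. x = (\<Sum>s\<in>S. act (a s) s)))"

text \<open>\<open>R d\<close> and \<open>M d\<close> are the homogeneous components of the ring and of the module; the assumption
  \<open>decomposition\<close> says that the module is the internal direct sum of the \<open>M d\<close>.\<close>

locale graded_left_module = left_module act
  for R :: "int \<Rightarrow> 'r::ring_1 set"
    and act :: "'r \<Rightarrow> 'm::ab_group_add \<Rightarrow> 'm"
    and M :: "int \<Rightarrow> 'm set" +
  assumes component_zero: "0 \<in> M d"
    and component_add: "x \<in> M d \<Longrightarrow> y \<in> M d \<Longrightarrow> x + y \<in> M d"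
    and component_uminus: "x \<in> M d \<Longrightarrow> - x \<in> M d"
    and decomposition: "\<exists>!c. (\<forall>d. c d \<in> M d) \<and> finite {d. c d \<noteq> 0} \<and> x = (\<Sum>d | c d \<noteq> 0. c d)"
    and component_act: "a \<in> R e \<Longrightarrow> x \<in> M d \<Longrightarrow> act a x \<in> M (e + d)"

section \<open>Generalized Eulerian modules\<close>

text \<open>The zero element lies in every \<open>M d\<close>, but satisfies the conditions below for every \<open>d\<close>.\<close>

definition generalized_eulerian ::
    "(('n::finite, 'k::field) weyl \<Rightarrow> 'm::ab_group_add \<Rightarrow> 'm) \<Rightarrow> (int \<Rightarrow> 'm set) \<Rightarrow> bool"
  where "generalized_eulerian act M \<longleftrightarrow>
    (\<forall>d. \<forall>w\<in>M d. \<exists>a>0. act ((euler - of_int d) ^ a) w = 0)"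

definition strongly_generalized_eulerian ::
    "(('n::finite, 'k::field) weyl \<Rightarrow> 'm::ab_group_add \<Rightarrow> 'm) \<Rightarrow> (int \<Rightarrow> 'm set) \<Rightarrow> bool"
  where "strongly_generalized_eulerian act M \<longleftrightarrow>
    (\<exists>a>0. \<forall>d. \<forall>w\<in>M d. act ((euler - of_int d) ^ a) w = 0)"

end

theory Submission
  imports Defs
begin

text \<open>
  Only the passage from the pointwise to the uniform exponent needs an argument. A homogeneous
  element \<open>b\<close> of the Weyl algebra of degree \<open>e\<close> shifts the eigenvalues of the Euler operator by \<open>e\<close>:
  \<open>(\<E> - (e + d)) b = b (\<E> - d)\<close>, see \<open>euler_shift_power\<close>. Hence if a module element \<open>w\<close> of
  degree \<open>d\<close> is killed by \<open>(\<E> - d)^N\<close>, then \<open>b w\<close>, of degree \<open>e + d\<close>, is killed by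
  \<open>(\<E> - (e + d))^N\<close>, with the same exponent \<open>N\<close>.

  Fix \<open>N\<close> and consider the elements of the module all of whose homogeneous components, say of degree
  \<open>d\<close>, are killed by \<open>(\<E> - d)^N\<close>. They are closed under addition and, by the shift relation, under the
  generators of the Weyl algebra, so they form a submodule (\<open>euler_bounded_act\<close>). A finite
  generating set has only finitely many nonzero homogeneous components, so in a generalized Eulerian
  module one \<open>N\<close> is large enough for all of them (\<open>uniform_exponent\<close>). For this \<open>N\<close> the submodule is
  the whole module, and a homogeneous element is its own only component.
\<close>

text \<open>The Weyl algebra is a type of operators, cut out by an inductive set; this transports the
  induction on the construction of an operator to the ring structure.\<close>

lemma weyl_induct [case_names const X D add mult]:
  fixes b :: "('n, 'k::field) weyl"
  assumes const: "\<And>c. P (weyl_const c)"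
    and X: "\<And>i. P (weyl_X i)"
    and D: "\<And>i. P (weyl_D i)"
    and add: "\<And>a b. P a \<Longrightarrow> P b \<Longrightarrow> P (a + b)"
    and mult: "\<And>a b. P a \<Longrightarrow> P b \<Longrightarrow> P (a * b)"
  shows "P b"
proof -
  have "P (Weyl f)" if "f \<in> weyl_ops" for f :: "('n, 'k) polyn \<Rightarrow> ('n, 'k) polyn"
    using that
  proof (induction rule: weyl_ops.induct)
    case (scalar c)
    then show ?case using const[of c] by (simp add: weyl_const_def)
  next
    case (var i)
    then show ?case using X[of i] by (simp add: weyl_X_def)
  next
    case (deriv i)
    then show ?case using D[of i] by (simp add: weyl_D_def)
  next
    case (add f g)
    then show ?case using assms(4)[of "Weyl f" "Weyl g"]
      by (simp add: plus_weyl.abs_eq eq_onp_def)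
  next
    case (comp f g)
    then show ?case using mult[of "Weyl f" "Weyl g"]
      by (simp add: times_weyl.abs_eq eq_onp_def)
  qed
  from this[OF weyl_app[of b]] show ?thesis
    by (simp add: weyl_app_inverse)
qed

section \<open>Commuting the Euler operator past homogeneous elements\<close>

lemma weyl_const_X: "weyl_const c * weyl_X i = weyl_X i * weyl_const c"
  by transfer (simp add: fun_eq_iff algebra_simps)

lemma polyn_deriv_const_mult: "polyn_deriv i (polyn_const c * p) = polyn_const c * polyn_deriv i p"
  by (induction p rule: polyn_induct)
    (simp_all add: polyn_deriv_add distrib_left polyn_const_def mult_single polyn_deriv_single
      mult.left_commute)

lemma weyl_const_D: "weyl_const c * weyl_D i = weyl_D i * weyl_const c"
  by transfer (simp add: fun_eq_iff polyn_deriv_const_mult)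

lemma euler_const:
  "euler * weyl_const c = (weyl_const c * euler :: ('n::finite, 'k::field) weyl)"
proof -
  have "(weyl_X i * weyl_D i) * weyl_const c = (weyl_const c * (weyl_X i * weyl_D i) :: ('n, 'k) weyl)"
    for i
    by (metis mult.assoc weyl_const_D weyl_const_X)
  then show ?thesis
    by (simp add: euler_def sum_distrib_left sum_distrib_right)
qed

lemma euler_X:
  "euler * weyl_X j = (weyl_X j * (euler + 1) :: ('n::finite, 'k::field) weyl)"
proof -
  have "(weyl_X i * weyl_D i) * weyl_X j =
      weyl_X j * (weyl_X i * weyl_D i) + (if i = j then weyl_X j else 0 :: ('n, 'k) weyl)" for i
  proof -
    have "(weyl_X i * weyl_D i) * weyl_X j = weyl_X i * (weyl_D i * weyl_X j)"
      by (rule mult.assoc)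
    also have "\<dots> = (weyl_X i * weyl_X j) * weyl_D i + (if i = j then weyl_X j else 0)"
      by (simp add: weyl_D_X distrib_left mult.assoc)
    also have "(weyl_X i * weyl_X j) * weyl_D i = weyl_X j * (weyl_X i * weyl_D i)"
      by (metis weyl_X_X mult.assoc)
    finally show ?thesis .
  qed
  then show ?thesis
    by (simp add: euler_def sum_distrib_left sum_distrib_right sum.distrib distrib_left)
qed

lemma euler_D:
  "euler * weyl_D j = (weyl_D j * (euler - 1) :: ('n::finite, 'k::field) weyl)"
proof -
  have "weyl_D j * (weyl_X i * weyl_D i) =
      (weyl_X i * weyl_D i) * weyl_D j + (if j = i then weyl_D j else 0 :: ('n, 'k) weyl)" for i
  proof -
    have "weyl_D j * (weyl_X i * weyl_D i) = (weyl_D j * weyl_X i) * weyl_D i"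
      by (rule mult.assoc[symmetric])
    also have "\<dots> = weyl_X i * (weyl_D j * weyl_D i) + (if j = i then weyl_D j else 0)"
      by (simp add: weyl_D_X distrib_right mult.assoc)
    also have "weyl_X i * (weyl_D j * weyl_D i) = (weyl_X i * weyl_D i) * weyl_D j"
      by (metis weyl_D_D mult.assoc)
    finally show ?thesis .
  qed
  then have "weyl_D j * euler = (euler * weyl_D j + weyl_D j :: ('n, 'k) weyl)"
    by (simp add: euler_def sum_distrib_left sum_distrib_right sum.distrib)
  then show ?thesis
    by (simp add: right_diff_distrib)
qed

text \<open>The commutator with the Euler operator is a derivation, so the degrees of \<open>X\<^sub>i\<close>, \<open>\<partial>\<^sub>i\<close> and the
  constants, which are its eigenvalues there, add up along products.\<close>

lemma euler_hom: "weyl_hom e b \<Longrightarrow> euler * b = b * (euler + of_int e)"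
proof (induction rule: weyl_hom.induct)
  case (mult d a e b)
  have "euler * (a * b) = a * ((euler + of_int d) * b)"
    by (simp add: mult.IH(1) flip: mult.assoc)
  also have "(euler + of_int d) * b = b * (euler + of_int (d + e))"
    by (simp add: distrib_left distrib_right mult.IH(2) mult_of_int_commute add_ac)
  finally show ?case by (simp add: mult.assoc)
qed (simp_all add: euler_const euler_X euler_D distrib_left distrib_right)

lemma euler_shift_power:
  assumes "weyl_hom e b"
  shows "(euler - of_int (e + d)) ^ N * b = b * (euler - of_int d) ^ N"
proof (induction N)
  case (Suc N)
  have "(euler - of_int (e + d)) * b = b * (euler - of_int d)"
    using euler_hom[OF assms]
    by (simp add: algebra_simps mult_of_int_commute)
  then have "(euler - of_int (e + d)) ^ N * ((euler - of_int (e + d)) * b) =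
      b * (euler - of_int d) ^ N * (euler - of_int d)"
    using Suc by (simp only: flip: mult.assoc)
  then show ?case
    by (simp only: power_Suc2 mult.assoc)
qed simp

section \<open>Homogeneous components\<close>

context left_module
begin

lemma act_zero_right: "act a 0 = 0"
  using act_add_right[of a 0 0] by simp

lemma act_sum_right: "act a (sum f A) = (\<Sum>x\<in>A. act a (f x))"
  by (induction A rule: infinite_finite_induct) (simp_all add: act_zero_right act_add_right)

lemma act_power_mono: "act (r ^ m) x = 0 \<Longrightarrow> m \<le> n \<Longrightarrow> act (r ^ n) x = 0"
  by (metis act_mult act_zero_right le_add_diff_inverse2 power_add)

end

context graded_left_module
begin

definition component :: "'m \<Rightarrow> int \<Rightarrow> 'm"
  where "component x =
    (THE c. (\<forall>d. c d \<in> M d) \<and> finite {d. c d \<noteq> 0} \<and> x = (\<Sum>d | c d \<noteq> 0. c d))"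

lemma component_in: "component x d \<in> M d"
  and finite_component: "finite {d. component x d \<noteq> 0}"
  and sum_component: "(\<Sum>d | component x d \<noteq> 0. component x d) = x"
  using theI'[OF decomposition[of x]] by (auto simp: component_def)

lemma component_eqI:
  assumes "\<And>d. c d \<in> M d" "finite F" "\<And>d. d \<notin> F \<Longrightarrow> c d = 0" "x = sum c F"
  shows "component x = c"
proof -
  have sub: "{d. c d \<noteq> 0} \<subseteq> F"
    using assms(3) by auto
  have "sum c F = (\<Sum>d | c d \<noteq> 0. c d)"
    by (rule sum.mono_neutral_right) (use sub assms(2) in auto)
  with assms sub show ?thesis
    unfolding component_def by (intro the1_equality decomposition) (auto intro: finite_subset)
qed

lemma sum_component_superset:
  assumes "finite F" "{d. component x d \<noteq> 0} \<subseteq> F"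
  shows "sum (component x) F = x"
proof -
  have "sum (component x) F = (\<Sum>d | component x d \<noteq> 0. component x d)"
    using assms by (intro sum.mono_neutral_right) auto
  then show ?thesis by (simp add: sum_component)
qed

lemma component_plus: "component (x + y) = (\<lambda>d. component x d + component y d)"
proof (rule component_eqI)
  let ?F = "{d. component x d \<noteq> 0} \<union> {d. component y d \<noteq> 0}"
  show "finite ?F" by (simp add: finite_component)
  then show "x + y = (\<Sum>d\<in>?F. component x d + component y d)"
    by (simp add: sum.distrib sum_component_superset)
qed (auto intro: component_add component_in)

lemma component_homogeneous:
  assumes "x \<in> M d"
  shows "component x = (\<lambda>e. if e = d then x else 0)"
  by (rule component_eqI[where F = "{d}"]) (use assms component_zero in auto)

lemma component_act_homogeneous:
  assumes "a \<in> R e"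
  shows "component (act a x) = (\<lambda>d. act a (component x (d - e)))"
proof (rule component_eqI)
  let ?F = "{d. component x d \<noteq> 0}"
  show "act a (component x (d - e)) \<in> M d" for d
    using component_act[OF assms component_in[of x "d - e"]] by simp
  show "finite ((+) e ` ?F)" by (simp add: finite_component)
  show "act a (component x (d - e)) = 0" if "d \<notin> (+) e ` ?F" for d
  proof -
    have "component x (d - e) = 0"
      using that image_eqI[of d "(+) e" "d - e" ?F] by auto
    then show ?thesis by (simp add: act_zero_right)
  qed
  have "act a x = (\<Sum>d\<in>?F. act a (component x d))"
    using act_sum_right[of a "component x" ?F] by (simp add: sum_component)
  then show "act a x = (\<Sum>d\<in>(+) e ` ?F. act a (component x (d - e)))"
    by (simp add: sum.reindex)
qed

end

section \<open>Elements with a common exponent\<close>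

locale graded_weyl_module = graded_left_module weyl_component act M
  for act :: "('n::finite, 'k::field) weyl \<Rightarrow> 'm::ab_group_add \<Rightarrow> 'm"
    and M :: "int \<Rightarrow> 'm set"
begin

definition euler_bounded :: "nat \<Rightarrow> 'm \<Rightarrow> bool"
  where "euler_bounded N x \<longleftrightarrow> (\<forall>d. act ((euler - of_int d) ^ N) (component x d) = 0)"

lemma euler_bounded_add: "euler_bounded N x \<Longrightarrow> euler_bounded N y \<Longrightarrow> euler_bounded N (x + y)"
  by (simp add: euler_bounded_def component_plus act_add_right)

lemma euler_bounded_zero: "euler_bounded N 0"
  using component_homogeneous[OF component_zero]
  by (simp add: euler_bounded_def act_zero_right)

lemma euler_bounded_sum: "(\<And>s. s \<in> S \<Longrightarrow> euler_bounded N (f s)) \<Longrightarrow> euler_bounded N (sum f S)"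
  by (induction S rule: infinite_finite_induct) (simp_all add: euler_bounded_zero euler_bounded_add)

lemma euler_bounded_act_homogeneous:
  assumes "weyl_hom e b" "euler_bounded N x"
  shows "euler_bounded N (act b x)"
  unfolding euler_bounded_def
proof
  fix d
  have "b \<in> weyl_component e"
    using assms(1) by (simp add: weyl_component_def)
  then have "act ((euler - of_int d) ^ N) (component (act b x) d) =
      act ((euler - of_int (e + (d - e))) ^ N * b) (component x (d - e))"
    by (simp add: component_act_homogeneous act_mult)
  also have "\<dots> = act b (act ((euler - of_int (d - e)) ^ N) (component x (d - e)))"
    by (simp only: euler_shift_power[OF assms(1)] act_mult)
  also have "\<dots> = 0"
    using assms(2) by (simp only: euler_bounded_def act_zero_right)
  finally show "act ((euler - of_int d) ^ N) (component (act b x) d) = 0" .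
qed

text \<open>The operators that preserve the bounded elements are closed under sums and products, and
  they contain the constants, the \<open>X\<^sub>i\<close> and the \<open>\<partial>\<^sub>i\<close> because these are homogeneous. A general
  operator therefore need not be split into homogeneous parts.\<close>

lemma euler_bounded_act: "euler_bounded N x \<Longrightarrow> euler_bounded N (act b x)"
proof (induction b arbitrary: x rule: weyl_induct)
  case (add a b)
  then show ?case by (simp only: act_add_left euler_bounded_add)
next
  case (mult a b)
  then show ?case by (simp only: act_mult)
qed (erule euler_bounded_act_homogeneous[rotated], rule weyl_hom.intros)+

lemma euler_bounded_homogeneous_iff:
  assumes "w \<in> M d"
  shows "euler_bounded N w \<longleftrightarrow> act ((euler - of_int d) ^ N) w = 0"
  using assms by (auto simp: euler_bounded_def component_homogeneous act_zero_right)

lemma uniform_exponent: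
  assumes "generalized_eulerian act M" "finite S"
  obtains N where "N > 0" "\<And>s. s \<in> S \<Longrightarrow> euler_bounded N s"
proof -
  have "\<forall>s d. \<exists>a. act ((euler - of_int d) ^ a) (component s d) = 0"
    using assms(1) component_in unfolding generalized_eulerian_def by blast
  then obtain a where a: "act ((euler - of_int d) ^ a s d) (component s d) = 0" for s d
    by metis
  \<comment> \<open>A sum serves as the upper bound, since unlike a maximum it needs no nonempty index set.\<close>
  let ?F = "\<lambda>s. {d. component s d \<noteq> 0}"
  define N where "N = Suc (\<Sum>s\<in>S. \<Sum>d\<in>?F s. a s d)"
  have "act ((euler - of_int d) ^ N) (component s d) = 0" if "s \<in> S" for s d
  proof (cases "component s d = 0")
    case True
    then show ?thesis by (simp add: act_zero_right)
  next
    case False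
    have "a s d \<le> (\<Sum>d\<in>?F s. a s d)"
      by (rule member_le_sum) (use False finite_component in auto)
    also have "\<dots> \<le> (\<Sum>s\<in>S. \<Sum>d\<in>?F s. a s d)"
      by (rule member_le_sum) (use that assms(2) in auto)
    finally have "a s d \<le> N" by (simp add: N_def)
    with a show ?thesis by (rule act_power_mono)
  qed
  then show thesis
    by (intro that[of N]) (simp_all add: euler_bounded_def N_def)
qed

end

theorem proposition3p7:
  fixes act :: "('n::finite, 'k::field_char_0) weyl \<Rightarrow> 'm::ab_group_add \<Rightarrow> 'm"
    and M :: "int \<Rightarrow> 'm set"
  assumes "graded_left_module weyl_component act M"
    and "finitely_generated act"
  shows "generalized_eulerian act M \<longleftrightarrow> strongly_generalized_eulerian act M"
proof
  interpret graded_weyl_module act M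
    using assms(1) by (simp add: graded_weyl_module_def)
  assume gen: "generalized_eulerian act M"
  obtain S where S: "finite S" "\<And>x. \<exists>a. x = (\<Sum>s\<in>S. act (a s) s)"
    using assms(2) unfolding finitely_generated_def by blast
  obtain N where N: "N > 0" "\<And>s. s \<in> S \<Longrightarrow> euler_bounded N s"
    using uniform_exponent[OF gen S(1)] by blast
  have "euler_bounded N x" for x
  proof -
    obtain a where "x = (\<Sum>s\<in>S. act (a s) s)" using S(2) by blast
    then show ?thesis by (simp add: euler_bounded_sum euler_bounded_act N(2))
  qed
  then show "strongly_generalized_eulerian act M"
    using N(1) euler_bounded_homogeneous_iff unfolding strongly_generalized_eulerian_def by blast
next
  assume "strongly_generalized_eulerian act M"
  then show "generalized_eulerian act M"
    unfolding strongly_generalized_eulerian_def generalized_eulerian_def by blast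
qed

end
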